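(* Let $a,b,d,h$ be real numbers with $a>b>0$, $a-b\geq d>0$ and $h>0$, and let $A,B,C,D$ be real constants. Consider the system in $(x,y,z)\in\mathbf{R}^3$ $$\left\{\begin{array}{l}(a^2y^2+d^2y^2-a^2b^2)(z-h)^2-2dh\,x\,y^2(z-h)+b^2h^2x^2=0,\\[1ex] Ax+By+Cz+D=0.\end{array}\right.$$ If the solution of this system exists, then it is not a non-degenerated conic.
   Context: The first equation is that of a right conoid of the fourth order whose directrices are the cubic egg curve $b^2x^2+a^2y^2+2dxy^2+d^2y^2-a^2b^2=0$ in the plane $z=0$, the straight line $x=0,\ z=h$, and the line at infinity of the plane $y=0$. The second equation is that of a cutting plane, so the solution of the system is the plane section of the conoid. A non-degenerated conic is an ellipse (including a circle), a parabola, or a hyperbola lying in a plane. *)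

theory Defs
  imports "HOL-Analysis.Analysis"
begin

text \<open>Conics in space, given by their standard equations in a Cartesian coordinate system
  (origin \<open>c\<close>, orthonormal axes \<open>u\<close>, \<open>v\<close>) of the plane in which they lie.
  Circles are the ellipses with \<open>p = q\<close>; a hyperbola consists of both branches.\<close>

definition is_ellipse :: "(real ^ 3) set \<Rightarrow> bool" where
  "is_ellipse S \<longleftrightarrow> (\<exists>c u v p q. norm u = 1 \<and> norm v = 1 \<and> u \<bullet> v = 0 \<and> p > 0 \<and> q > 0 \<and>
     S = {c + s *\<^sub>R u + t *\<^sub>R v | s t. s\<^sup>2 / p\<^sup>2 + t\<^sup>2 / q\<^sup>2 = 1})"

definition is_parabola :: "(real ^ 3) set \<Rightarrow> bool" where
  "is_parabola S \<longleftrightarrow> (\<exists>c u v p. norm u = 1 \<and> norm v = 1 \<and> u \<bullet> v = 0 \<and> p > 0 \<and>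
     S = {c + s *\<^sub>R u + t *\<^sub>R v | s t. t\<^sup>2 = 2 * p * s})"

definition is_hyperbola :: "(real ^ 3) set \<Rightarrow> bool" where
  "is_hyperbola S \<longleftrightarrow> (\<exists>c u v p q. norm u = 1 \<and> norm v = 1 \<and> u \<bullet> v = 0 \<and> p > 0 \<and> q > 0 \<and>
     S = {c + s *\<^sub>R u + t *\<^sub>R v | s t. s\<^sup>2 / p\<^sup>2 - t\<^sup>2 / q\<^sup>2 = 1})"

definition nondegenerate_conic :: "(real ^ 3) set \<Rightarrow> bool" where
  "nondegenerate_conic S \<longleftrightarrow> is_ellipse S \<or> is_parabola S \<or> is_hyperbola S"

end

theory Submission imports Defs begin

text \<open>A non-degenerate conic has no three collinear points, so it suffices to find three collinear
  points on every section with at least two points.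
  The substitution \<open>x = t w / h\<close> with \<open>w = z - h\<close> turns the conoid into
  \<open>w\<^sup>2 (y\<^sup>2 (a\<^sup>2 + d\<^sup>2 - 2 d t) - b\<^sup>2 (a\<^sup>2 - t\<^sup>2)) = 0\<close>: over each \<open>t\<close>
  with \<open>|t| < a\<close> lie two rulings \<open>y = const\<close> meeting the double line \<open>x = w = 0\<close>.
  A plane that meets this double line in one point \<open>O\<close> contains, in the generic plane through
  the double line, \<open>O\<close> and one point on each of the two rulings, unless it is a plane
  \<open>y = const\<close>, whose section is a cone with apex \<open>O\<close>. A plane parallel to the
  double line cuts out a curve whose component over \<open>[-a, a]\<close> and whose further branch
  over \<open>2 d t > a\<^sup>2 + d\<^sup>2\<close> are both met by a line through a point with \<open>y = 0\<close>.\<close>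

section \<open>Lines and non-degenerate conics\<close>

lemma orthonormal_coords_eq:
  fixes c u v :: "'a::real_inner"
  assumes "norm u = 1" "norm v = 1" "u \<bullet> v = 0"
    and eq: "c + s *\<^sub>R u + t *\<^sub>R v = c + s' *\<^sub>R u + t' *\<^sub>R v"
  shows "s = s'" "t = t'"
proof -
  have uu: "u \<bullet> u = 1" and vv: "v \<bullet> v = 1" and vu: "v \<bullet> u = 0"
    using assms by (simp_all add: norm_eq_1 inner_commute)
  have e: "s *\<^sub>R u + t *\<^sub>R v = s' *\<^sub>R u + t' *\<^sub>R v"
    using eq by (simp add: add.assoc)
  have "(s *\<^sub>R u + t *\<^sub>R v) \<bullet> u = (s' *\<^sub>R u + t' *\<^sub>R v) \<bullet> u"
    by (simp only: e)
  then show "s = s'" using uu vu by (simp add: inner_add_left)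
  have "(s *\<^sub>R u + t *\<^sub>R v) \<bullet> v = (s' *\<^sub>R u + t' *\<^sub>R v) \<bullet> v"
    by (simp only: e)
  then show "t = t'" using vv assms(3) by (simp add: inner_add_left)
qed

text \<open>The hypotheses give \<open>\<alpha> + \<beta> X + \<gamma> X^2\<close> the zeros 0, 1
  and \<open>l\<close>, too many for degree two. Below, this polynomial is the equation of a conic
  along a line \<open>PQ\<close>, with \<open>P\<close> at 0 and \<open>Q\<close> at 1.\<close>

lemma quadratic_three_zeros:
  fixes \<alpha> \<beta> \<gamma> l :: real
  assumes "\<alpha> = 0" "\<alpha> + \<beta> + \<gamma> = 0" "\<alpha> + \<beta> * l + \<gamma> * l\<^sup>2 = 0" "l \<noteq> 0" "l \<noteq> 1"
  shows "\<beta> = 0" "\<gamma> = 0"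
proof -
  have b: "\<beta> = - \<gamma>" using assms by linarith
  have "\<gamma> * (l * (l - 1)) = 0"
    using assms(1,3) unfolding b by (simp add: algebra_simps power2_eq_square)
  then show "\<gamma> = 0" using assms by simp
  with b show "\<beta> = 0" by simp
qed

text \<open>Points of the line \<open>PQ\<close> have interpolated plane coordinates, so for each
  type of conic only the hypothesis on \<open>f\<close> remains, a statement about its equation in
  two real variables.\<close>

lemma planar_curve_no_three_collinear:
  fixes c u v :: "'a::real_inner"
  assumes on: "norm u = 1" "norm v = 1" "u \<bullet> v = 0"
    and f: "\<And>s t s' t' l. f (s + l * (s' - s)) (t + l * (t' - t)) = (0::real) \<Longrightarrow> f s t = 0 \<Longrightarrow>
         f s' t' = 0 \<Longrightarrow> l \<noteq> 0 \<Longrightarrow> l \<noteq> 1 \<Longrightarrow> s = s' \<and> t = t'"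
    and S: "S = {c + s *\<^sub>R u + t *\<^sub>R v | s t. f s t = 0}"
    and PQ: "P \<in> S" "Q \<in> S" "P \<noteq> Q" and l: "l \<noteq> 0" "l \<noteq> 1"
  shows "P + l *\<^sub>R (Q - P) \<notin> S"
proof
  assume R: "P + l *\<^sub>R (Q - P) \<in> S"
  obtain s t where P: "P = c + s *\<^sub>R u + t *\<^sub>R v" "f s t = 0" using PQ S by auto
  obtain s' t' where Q: "Q = c + s' *\<^sub>R u + t' *\<^sub>R v" "f s' t' = 0" using PQ S by auto
  obtain s'' t'' where R': "P + l *\<^sub>R (Q - P) = c + s'' *\<^sub>R u + t'' *\<^sub>R v" "f s'' t'' = 0"
    using R S by auto
  have "P + l *\<^sub>R (Q - P) = c + (s + l * (s' - s)) *\<^sub>R u + (t + l * (t' - t)) *\<^sub>R v"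
    unfolding P(1) Q(1) by (simp add: algebra_simps)
  then have e: "c + (s + l * (s' - s)) *\<^sub>R u + (t + l * (t' - t)) *\<^sub>R v = c + s'' *\<^sub>R u + t'' *\<^sub>R v"
    using R'(1) by simp
  have "f (s + l * (s' - s)) (t + l * (t' - t)) = 0"
    using orthonormal_coords_eq[OF on e] R'(2) by simp
  from f[OF this P(2) Q(2) l] show False using PQ(3) P(1) Q(1) by simp
qed

text \<open>The coefficient of \<open>l^2\<close> along the line is a positive definite form in the
  direction, so it vanishes only if the two points coincide.\<close>

lemma ellipse_no_three_collinear:
  assumes "is_ellipse S" and PQ: "P \<in> S" "Q \<in> S" "P \<noteq> Q" and l: "l \<noteq> 0" "l \<noteq> 1"
  shows "P + l *\<^sub>R (Q - P) \<notin> S"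
proof -
  obtain c u v p q where on: "norm u = 1" "norm v = 1" "u \<bullet> v = 0" and pq: "p > 0" "q > 0" and
     S: "S = {c + s *\<^sub>R u + t *\<^sub>R v | s t. s\<^sup>2 / p\<^sup>2 + t\<^sup>2 / q\<^sup>2 = 1}"
    using assms(1) unfolding is_ellipse_def by blast
  let ?f = "\<lambda>s t. (s / p)\<^sup>2 + (t / q)\<^sup>2 - 1"
  show ?thesis
  proof (rule planar_curve_no_three_collinear[OF on _ _ PQ l, where f = ?f])
    fix s t s' t' l :: real
    assume A: "?f (s + l * (s' - s)) (t + l * (t' - t)) = 0" "?f s t = 0" "?f s' t' = 0"
      and l: "l \<noteq> 0" "l \<noteq> 1"
    let ?g = "((s' - s) / p)\<^sup>2 + ((t' - t) / q)\<^sup>2"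
    let ?b = "2 * ((s / p) * ((s' - s) / p) + (t / q) * ((t' - t) / q))"
    have "?f s' t' = ?f s t + ?b + ?g"
      by (simp add: power2_eq_square diff_divide_distrib algebra_simps)
    then have 1: "?f s t + ?b + ?g = 0" using A(3) by simp
    have "?f (s + l * (s' - s)) (t + l * (t' - t)) = ?f s t + ?b * l + ?g * l\<^sup>2"
      by (simp add: power2_eq_square diff_divide_distrib add_divide_distrib algebra_simps)
    then have 2: "?f s t + ?b * l + ?g * l\<^sup>2 = 0" using A(1) by simp
    have "?g = 0" using quadratic_three_zeros(2)[OF A(2) 1 2 l] .
    then show "s = s' \<and> t = t'" using pq by (simp add: sum_power2_eq_zero_iff)
  qed (simp add: S power_divide)
qed

text \<open>The quadratic coefficient forces \<open>t' = t\<close>; the linear one then leaves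
  \<open>p * (s' - s) = 0\<close>.\<close>

lemma parabola_no_three_collinear:
  assumes "is_parabola S" and PQ: "P \<in> S" "Q \<in> S" "P \<noteq> Q" and l: "l \<noteq> 0" "l \<noteq> 1"
  shows "P + l *\<^sub>R (Q - P) \<notin> S"
proof -
  obtain c u v p where on: "norm u = 1" "norm v = 1" "u \<bullet> v = 0" and p: "p > 0" and
     S: "S = {c + s *\<^sub>R u + t *\<^sub>R v | s t. t\<^sup>2 = 2 * p * s}"
    using assms(1) unfolding is_parabola_def by blast
  let ?f = "\<lambda>s t. t\<^sup>2 - 2 * p * s"
  show ?thesis
  proof (rule planar_curve_no_three_collinear[OF on _ _ PQ l, where f = ?f])
    fix s t s' t' l :: real
    assume A: "?f (s + l * (s' - s)) (t + l * (t' - t)) = 0" "?f s t = 0" "?f s' t' = 0"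
      and l: "l \<noteq> 0" "l \<noteq> 1"
    let ?g = "(t' - t)\<^sup>2"
    let ?b = "2 * (t * (t' - t) - p * (s' - s))"
    have "?f s' t' = ?f s t + ?b + ?g"
      by (simp add: power2_eq_square algebra_simps)
    then have 1: "?f s t + ?b + ?g = 0" using A(3) by simp
    have "?f (s + l * (s' - s)) (t + l * (t' - t)) = ?f s t + ?b * l + ?g * l\<^sup>2"
      by (simp add: power2_eq_square algebra_simps)
    then have 2: "?f s t + ?b * l + ?g * l\<^sup>2 = 0" using A(1) by simp
    show "s = s' \<and> t = t'" using quadratic_three_zeros[OF A(2) 1 2 l] p by simp
  qed (simp add: S)
qed

text \<open>The leading form is indefinite, so its vanishing still allows asymptotic directions;
  these are excluded by the linear coefficient at a point of the hyperbola.\<close>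

lemma hyperbola_no_three_collinear:
  assumes "is_hyperbola S" and PQ: "P \<in> S" "Q \<in> S" "P \<noteq> Q" and l: "l \<noteq> 0" "l \<noteq> 1"
  shows "P + l *\<^sub>R (Q - P) \<notin> S"
proof -
  obtain c u v p q where on: "norm u = 1" "norm v = 1" "u \<bullet> v = 0" and pq: "p > 0" "q > 0" and
     S: "S = {c + s *\<^sub>R u + t *\<^sub>R v | s t. s\<^sup>2 / p\<^sup>2 - t\<^sup>2 / q\<^sup>2 = 1}"
    using assms(1) unfolding is_hyperbola_def by blast
  let ?f = "\<lambda>s t. (s / p)\<^sup>2 - (t / q)\<^sup>2 - 1"
  show ?thesis
  proof (rule planar_curve_no_three_collinear[OF on _ _ PQ l, where f = ?f])
    fix s t s' t' l :: real
    assume A: "?f (s + l * (s' - s)) (t + l * (t' - t)) = 0" "?f s t = 0" "?f s' t' = 0"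
      and l: "l \<noteq> 0" "l \<noteq> 1"
    define X where "X = s / p"
    define Y where "Y = t / q"
    define X' where "X' = (s' - s) / p"
    define Y' where "Y' = (t' - t) / q"
    let ?g = "X'\<^sup>2 - Y'\<^sup>2"
    let ?b = "2 * (X * X' - Y * Y')"
    have "?f s' t' = ?f s t + ?b + ?g"
      unfolding X_def Y_def X'_def Y'_def
      by (simp add: power2_eq_square diff_divide_distrib algebra_simps)
    then have 1: "?f s t + ?b + ?g = 0" using A(3) by simp
    have "?f (s + l * (s' - s)) (t + l * (t' - t)) = ?f s t + ?b * l + ?g * l\<^sup>2"
      unfolding X_def Y_def X'_def Y'_def
      by (simp add: power2_eq_square diff_divide_distrib add_divide_distrib algebra_simps)
    then have 2: "?f s t + ?b * l + ?g * l\<^sup>2 = 0" using A(1) by simp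
    have b: "X * X' = Y * Y'" and g: "X'\<^sup>2 = Y'\<^sup>2"
      using quadratic_three_zeros[OF A(2) 1 2 l] by simp_all
    have "X\<^sup>2 - Y\<^sup>2 = 1" using A(2) by (simp add: X_def Y_def)
    \<comment> \<open>This is the previous equation multiplied by \<open>X'^2\<close>; next,
      \<open>b\<close> and \<open>g\<close> turn the right side into
      \<open>(Y Y')^2 - Y^2 Y'^2\<close>.\<close>
    then have "X'\<^sup>2 = (X * X')\<^sup>2 - Y\<^sup>2 * X'\<^sup>2"
      by (simp add: power_mult_distrib flip: left_diff_distrib)
    also have "\<dots> = 0" by (simp only: b g) (simp add: power_mult_distrib)
    finally have "X' = 0" by simp
    with g have "Y' = 0" by simp
    with \<open>X' = 0\<close> show "s = s' \<and> t = t'" using pq by (simp add: X'_def Y'_def)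
  qed (simp add: S power_divide)
qed

lemma nondegenerate_conic_no_three_collinear:
  assumes "nondegenerate_conic S" "P \<in> S" "Q \<in> S" "P \<noteq> Q" "l \<noteq> 0" "l \<noteq> 1"
  shows "P + l *\<^sub>R (Q - P) \<notin> S"
  using assms ellipse_no_three_collinear parabola_no_three_collinear hyperbola_no_three_collinear
  unfolding nondegenerate_conic_def by metis

text \<open>Provides a second point on a conical section of which only the apex is known.\<close>

lemma nondegenerate_conic_other_point:
  assumes "nondegenerate_conic S"
  shows "\<exists>P\<in>S. P \<noteq> R"
proof -
  have "\<exists>P\<in>S. \<exists>Q\<in>S. P \<noteq> Q"
    using assms unfolding nondegenerate_conic_def
  proof (elim disjE)
    assume "is_ellipse S"
    then obtain c u v p q where on: "norm u = 1" "norm v = 1" "u \<bullet> v = 0" and pq: "p > 0" "q > 0"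
      and S: "S = {c + s *\<^sub>R u + t *\<^sub>R v | s t. s\<^sup>2 / p\<^sup>2 + t\<^sup>2 / q\<^sup>2 = 1}"
      unfolding is_ellipse_def by blast
    have "p\<^sup>2 / p\<^sup>2 + 0\<^sup>2 / q\<^sup>2 = 1" "(- p)\<^sup>2 / p\<^sup>2 + 0\<^sup>2 / q\<^sup>2 = 1"
      using pq by simp_all
    then have "c + p *\<^sub>R u + 0 *\<^sub>R v \<in> S" "c + (- p) *\<^sub>R u + 0 *\<^sub>R v \<in> S"
      unfolding S by blast+
    moreover have "c + p *\<^sub>R u + 0 *\<^sub>R v \<noteq> c + (- p) *\<^sub>R u + 0 *\<^sub>R v"
      using orthonormal_coords_eq(1)[OF on] pq(1) by fastforce
    ultimately show ?thesis by blast
  next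
    assume "is_parabola S"
    then obtain c u v p where on: "norm u = 1" "norm v = 1" "u \<bullet> v = 0" and p: "p > 0"
      and S: "S = {c + s *\<^sub>R u + t *\<^sub>R v | s t. t\<^sup>2 = 2 * p * s}"
      unfolding is_parabola_def by blast
    have "(2 * p)\<^sup>2 = 2 * p * (2 * p)" "0\<^sup>2 = 2 * p * 0" by (simp_all add: power2_eq_square)
    then have "c + (2 * p) *\<^sub>R u + (2 * p) *\<^sub>R v \<in> S" "c + 0 *\<^sub>R u + 0 *\<^sub>R v \<in> S"
      unfolding S by blast+
    moreover have "c + (2 * p) *\<^sub>R u + (2 * p) *\<^sub>R v \<noteq> c + 0 *\<^sub>R u + 0 *\<^sub>R v"
      using orthonormal_coords_eq(1)[OF on] p by fastforce
    ultimately show ?thesis by blast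
  next
    assume "is_hyperbola S"
    then obtain c u v p q where on: "norm u = 1" "norm v = 1" "u \<bullet> v = 0" and pq: "p > 0" "q > 0"
      and S: "S = {c + s *\<^sub>R u + t *\<^sub>R v | s t. s\<^sup>2 / p\<^sup>2 - t\<^sup>2 / q\<^sup>2 = 1}"
      unfolding is_hyperbola_def by blast
    have "p\<^sup>2 / p\<^sup>2 - 0\<^sup>2 / q\<^sup>2 = 1" "(- p)\<^sup>2 / p\<^sup>2 - 0\<^sup>2 / q\<^sup>2 = 1"
      using pq by simp_all
    then have "c + p *\<^sub>R u + 0 *\<^sub>R v \<in> S" "c + (- p) *\<^sub>R u + 0 *\<^sub>R v \<in> S"
      unfolding S by blast+
    moreover have "c + p *\<^sub>R u + 0 *\<^sub>R v \<noteq> c + (- p) *\<^sub>R u + 0 *\<^sub>R v"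
      using orthonormal_coords_eq(1)[OF on] pq(1) by fastforce
    ultimately show ?thesis by blast
  qed
  then show ?thesis by metis
qed

section \<open>Secants of the egg curve after a projective change of coordinates\<close>

text \<open>The third point \<open>t3\<close> is chosen first and determines the slope; then \<open>t2\<close>
  comes from the intermediate value theorem.\<close>

lemma egg_secant:
  fixes a b d p q :: real
  assumes "a > d" "d > 0" "b > 0" and pq: "p \<noteq> 0 \<or> q \<noteq> 0"
  obtains \<sigma> t1 t2 t3 where "t1 \<noteq> t2" "t1 \<noteq> t3" "t2 \<noteq> t3"
    and "\<And>t. t \<in> {t1, t2, t3} \<Longrightarrow> p * t + q \<noteq> 0 \<and>
       (\<sigma> * (t - t1) / (p * t + q))\<^sup>2 * (a\<^sup>2 + d\<^sup>2 - 2 * d * t) = b\<^sup>2 * (a\<^sup>2 - t\<^sup>2)"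
proof -
  define k where "k = a\<^sup>2 + d\<^sup>2"
  have k: "k > 2 * d * a"
  proof -
    have "0 < (a - d)\<^sup>2" using assms by simp
    then show ?thesis by (simp add: k_def power2_eq_square algebra_simps)
  qed
  \<comment> \<open>With \<open>x = - t\<close>, the equation
    \<open>y^2 (k - 2 d t) = b^2 (a^2 - t^2)\<close> is that of the egg curve. At
    \<open>t = a\<close> and \<open>t = - a\<close> it holds with \<open>y = 0\<close>, so the point
    of \<open>t1\<close> lies on the curve for every \<open>\<sigma>\<close>.\<close>
  obtain t1 where t1: "t1 = a \<or> t1 = - a" "p * t1 + q \<noteq> 0"
  proof (cases "p * a + q = 0")
    case True
    have "p * (- a) + q \<noteq> 0"
    proof
      assume "p * (- a) + q = 0"
      with True have "p * a = 0" "q = 0" by (simp_all add: algebra_simps)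
      with pq assms show False by simp
    qed
    then show ?thesis using that by blast
  qed (use that in blast)
  have "k / (2 * d) > a" using k assms by (simp add: field_simps)
  \<comment> \<open>Beyond \<open>k / (2 * d)\<close> both \<open>k - 2 d t\<close> and
    \<open>a^2 - t^2\<close> are negative, so the curve has real points there. Two candidates
    suffice, as \<open>p * t + q\<close> has at most one zero.\<close>
  obtain t3 where t3: "t3 > k / (2 * d)" "p * t3 + q \<noteq> 0"
  proof (cases "p * (k / (2 * d) + 1) + q = 0")
    case True
    have "p * (k / (2 * d) + 2) + q = p" using True by (simp add: algebra_simps)
    moreover have "p \<noteq> 0" using True pq by auto
    ultimately show ?thesis using that[of "k / (2 * d) + 2"] by simp
  next
    case False
    then show ?thesis using that[of "k / (2 * d) + 1"] by simp
  qed
  have t3a: "t3 > a" using t3 \<open>k / (2 * d) > a\<close> by linarith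
  have t3k: "2 * d * t3 > k" using t3 assms by (simp add: field_simps)
  have t13: "t3 - t1 > 0" "t3 + t1 > 0" using t1 t3a assms by auto
  \<comment> \<open>The value of \<open>\<sigma>^2\<close> that puts the point of \<open>t3\<close>
    on the curve.\<close>
  define m where "m = b\<^sup>2 * (t3 + t1) * (p * t3 + q)\<^sup>2 / ((t3 - t1) * (2 * d * t3 - k))"
  have m: "m > 0" unfolding m_def using t13 t3 t3k assms by simp
  \<comment> \<open>The curve equation with denominators cleared and the known factor
    \<open>t - t1\<close> divided out, using \<open>a^2 - t^2 = - (t - t1) (t + t1)\<close>.\<close>
  define \<Phi> where "\<Phi> = (\<lambda>t. m * (t - t1) * (k - 2 * d * t) + b\<^sup>2 * (t + t1) * (p * t + q)\<^sup>2)"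
  have \<Phi>3: "\<Phi> t3 = 0"
  proof -
    have "m * ((t3 - t1) * (2 * d * t3 - k)) = b\<^sup>2 * (t3 + t1) * (p * t3 + q)\<^sup>2"
      unfolding m_def using t13 t3k by simp
    then show ?thesis unfolding \<Phi>_def by (simp add: algebra_simps)
  qed
  have "k + 2 * d * a > 0" "k - 2 * d * a > 0" using k assms mult_pos_pos[of d a] by linarith+
  have kp: "m * (2 * a) * (k + 2 * d * a) > 0" "m * (2 * a) * (k - 2 * d * a) > 0"
    using m \<open>k + 2 * d * a > 0\<close> \<open>k - 2 * d * a > 0\<close> assms by simp_all
  have bp: "b\<^sup>2 * (2 * a) * (p * t1 + q)\<^sup>2 > 0" using t1(2) assms by simp
  \<comment> \<open>At each end one summand of \<open>\<Phi>\<close> vanishes; which one depends on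
    the choice of \<open>t1\<close>, but the sign of the other does not.\<close>
  have ends: "\<Phi> (- a) < 0" "\<Phi> a > 0"
  proof -
    have "\<Phi> (- a) < 0 \<and> \<Phi> a > 0"
      using t1(1)
    proof
      assume t: "t1 = a"
      have "\<Phi> (- a) = - (m * (2 * a) * (k + 2 * d * a))" "\<Phi> a = b\<^sup>2 * (2 * a) * (p * t1 + q)\<^sup>2"
        unfolding \<Phi>_def t by (simp_all add: algebra_simps)
      then show ?thesis using kp bp by linarith
    next
      assume t: "t1 = - a"
      have "\<Phi> (- a) = - (b\<^sup>2 * (2 * a) * (p * t1 + q)\<^sup>2)" "\<Phi> a = m * (2 * a) * (k - 2 * d * a)"
        unfolding \<Phi>_def t by (simp_all add: algebra_simps)
      then show ?thesis using kp bp by linarith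
    qed
    then show "\<Phi> (- a) < 0" "\<Phi> a > 0" by auto
  qed
  have "continuous_on {- a..a} \<Phi>" unfolding \<Phi>_def by (intro continuous_intros)
  then obtain t2 where t2: "- a \<le> t2" "t2 \<le> a" "\<Phi> t2 = 0"
    using IVT'[of \<Phi> "- a" 0 a] ends assms by force
  have t2a: "t2 \<noteq> a" "t2 \<noteq> - a" using t2 ends by auto
  have t2k: "k - 2 * d * t2 > 0"
    using k mult_left_mono[OF t2(2), of "2 * d"] assms by linarith
  have l2: "p * t2 + q \<noteq> 0"
  proof
    assume "p * t2 + q = 0"
    then have "m * (t2 - t1) * (k - 2 * d * t2) = 0" using t2(3) by (simp add: \<Phi>_def)
    then show False using m t2k t2a t1 by auto
  qed
  have curve: "(sqrt m * (t - t1) / (p * t + q))\<^sup>2 * (a\<^sup>2 + d\<^sup>2 - 2 * d * t) = b\<^sup>2 * (a\<^sup>2 - t\<^sup>2)"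
    if "p * t + q \<noteq> 0" "\<Phi> t = 0 \<or> t = t1" for t
  proof -
    have sq: "a\<^sup>2 - t\<^sup>2 = - ((t - t1) * (t + t1))"
      using t1(1) by (auto simp: power2_eq_square algebra_simps)
    have "(t - t1) * \<Phi> t = 0" using that(2) by auto
    then have "m * (t - t1)\<^sup>2 * (k - 2 * d * t) = b\<^sup>2 * (a\<^sup>2 - t\<^sup>2) * (p * t + q)\<^sup>2"
      unfolding sq \<Phi>_def by (simp add: algebra_simps power2_eq_square)
    then show ?thesis
      using that(1) m by (simp add: power_divide power_mult_distrib k_def divide_simps)
  qed
  show ?thesis
  proof (rule that[of t1 t2 t3 "sqrt m"])
    show "t1 \<noteq> t2" "t1 \<noteq> t3" "t2 \<noteq> t3" using t2a t1 t13 t3a t2 by auto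
  qed (use curve l2 t1 t3 t2 \<Phi>3 in auto)
qed

section \<open>Plane sections of the conoid\<close>

theorem theorem3p3:
  fixes a b d h A B C D :: real and S :: "(real ^ 3) set"
  assumes "a > b" "b > 0"
    and "a - b \<ge> d" "d > 0"
    and "h > 0"
    and "S = {P. \<exists>x y z. P = vector [x, y, z] \<and>
           (a\<^sup>2 * y\<^sup>2 + d\<^sup>2 * y\<^sup>2 - a\<^sup>2 * b\<^sup>2) * (z - h)\<^sup>2
             - 2 * d * h * x * y\<^sup>2 * (z - h) + b\<^sup>2 * h\<^sup>2 * x\<^sup>2 = 0 \<and>
           A * x + B * y + C * z + D = 0}"
    and "S \<noteq> {}"
  shows "\<not> nondegenerate_conic S"
proof
  assume nd: "nondegenerate_conic S"
  \<comment> \<open>The constant term of the plane equation once \<open>w = z - h\<close> replaces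
    \<open>z\<close>.\<close>
  define E where "E = D + C * h"
  define pt :: "real \<Rightarrow> real \<Rightarrow> real \<Rightarrow> real ^ 3" where "pt = (\<lambda>x y w. vector [x, y, w + h])"
  have pt_eq: "pt x y w = pt x' y' w' \<longleftrightarrow> x = x' \<and> y = y' \<and> w = w'" for x y w x' y' w'
    by (auto simp: pt_def vec_eq_iff forall_3)
  have pt_line: "pt x y w + l *\<^sub>R (pt x' y' w' - pt x y w)
      = pt (x + l * (x' - x)) (y + l * (y' - y)) (w + l * (w' - w))" for x y w x' y' w' l
    by (auto simp: pt_def vec_eq_iff forall_3 algebra_simps)
  define F where "F = (\<lambda>x y w. (a\<^sup>2 * y\<^sup>2 + d\<^sup>2 * y\<^sup>2 - a\<^sup>2 * b\<^sup>2) * w\<^sup>2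
             - 2 * d * h * x * y\<^sup>2 * w + b\<^sup>2 * h\<^sup>2 * x\<^sup>2)"
  have S_eq: "S = {pt x y w | x y w. F x y w = 0 \<and> A * x + B * y + C * w + E = 0}"
    (is "_ = ?S")
  proof (intro equalityI subsetI)
    fix P assume "P \<in> S"
    then obtain x y z where *: "P = vector [x, y, z]" "F x y (z - h) = 0"
      "A * x + B * y + C * z + D = 0" unfolding assms(6) F_def by blast
    then have "P = pt x y (z - h)" "A * x + B * y + C * (z - h) + E = 0"
      by (simp_all add: pt_def E_def algebra_simps)
    with *(2) show "P \<in> ?S" by blast
  next
    fix P assume "P \<in> ?S"
    then obtain x y w where *: "P = pt x y w" "F x y ((w + h) - h) = 0"
      "A * x + B * y + C * w + E = 0" by auto
    then have "P = vector [x, y, w + h]" "A * x + B * y + C * (w + h) + D = 0"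
      by (simp_all add: pt_def E_def algebra_simps)
    with *(2) show "P \<in> S" unfolding assms(6) F_def by blast
  qed
  have mem: "pt x y w \<in> S \<longleftrightarrow> F x y w = 0 \<and> A * x + B * y + C * w + E = 0" for x y w
    unfolding S_eq by (auto simp: pt_eq)
  have F_ruling: "F (t * w / h) y w = w\<^sup>2 * (y\<^sup>2 * (a\<^sup>2 + d\<^sup>2 - 2 * d * t) - b\<^sup>2 * (a\<^sup>2 - t\<^sup>2))"
    for t y w
    using assms(5) unfolding F_def by (simp add: field_simps power2_eq_square)
  have ad: "a > d" "a > 0" using assms by linarith+
  have three: False
    if "P \<in> S" "Q \<in> S" "P \<noteq> Q" "l \<noteq> 0" "l \<noteq> 1" "P + l *\<^sub>R (Q - P) \<in> S" for P Q l
    using nondegenerate_conic_no_three_collinear[OF nd] that by blast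
  \<comment> \<open>On the double line \<open>x = w = 0\<close> the plane equation reads
    \<open>B y + E = 0\<close>. The cases are: line contained in the section, empty section, plane
    parallel to the line, plane \<open>y = const\<close>, and any other plane meeting the line
    once.\<close>
  consider "B = 0" "E = 0" | "B = 0" "E \<noteq> 0" "A = 0" "C = 0" | "B = 0" "E \<noteq> 0" "A \<noteq> 0 \<or> C \<noteq> 0"
    | "B \<noteq> 0" "A = 0" "C = 0" | "B \<noteq> 0" "A \<noteq> 0 \<or> C \<noteq> 0" by blast
  then show False
  proof cases
    case 1
    have *: "pt 0 y 0 \<in> S" for y unfolding mem using 1 by (simp add: F_def)
    show False
      using three[of "pt 0 0 0" "pt 0 1 0" 2] * by (simp add: pt_line pt_eq)
  next
    case 2
    then show False using assms(7) S_eq by auto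
  next
    case 3
    obtain \<sigma> t1 t2 t3 where dist: "t1 \<noteq> t2" "t1 \<noteq> t3" "t2 \<noteq> t3"
      and egg: "\<And>t. t \<in> {t1, t2, t3} \<Longrightarrow> A * t + C * h \<noteq> 0 \<and>
       (\<sigma> * (t - t1) / (A * t + C * h))\<^sup>2 * (a\<^sup>2 + d\<^sup>2 - 2 * d * t) = b\<^sup>2 * (a\<^sup>2 - t\<^sup>2)"
    proof (rule egg_secant[OF ad(1) assms(4,2)])
      show "A \<noteq> 0 \<or> C * h \<noteq> 0" using 3 assms by auto
    qed blast
    \<comment> \<open>Solves the plane equation for \<open>w\<close> along
      \<open>x = t w / h\<close>.\<close>
    let ?w = "\<lambda>t. - E * h / (A * t + C * h)"
    let ?P = "\<lambda>t. pt (t * ?w t / h) (\<sigma> * (t - t1) / (A * t + C * h)) (?w t)"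
    have on: "?P t \<in> S" if "t \<in> {t1, t2, t3}" for t
    proof -
      have l: "A * t + C * h \<noteq> 0" using egg[OF that] by blast
      have "A * (t * ?w t / h) + C * ?w t + E = 0"
        using l assms(5) by (simp add: divide_simps) (simp add: algebra_simps)
      then show ?thesis unfolding mem F_ruling using egg[OF that] 3 by simp
    qed
    \<comment> \<open>The ratio at which the point of \<open>t3\<close> divides those of
      \<open>t1\<close> and \<open>t2\<close>.\<close>
    define l where "l = (t3 - t1) * (A * t2 + C * h) / ((t2 - t1) * (A * t3 + C * h))"
    have L: "A * t1 + C * h \<noteq> 0" "A * t2 + C * h \<noteq> 0" "A * t3 + C * h \<noteq> 0"
      using egg by auto
    have "l \<noteq> 0" using L dist by (simp add: l_def)
    have "l - 1 = (t3 - t2) * (A * t1 + C * h) / ((t2 - t1) * (A * t3 + C * h))"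
      unfolding l_def using L dist by (simp add: divide_simps) (simp add: algebra_simps)
    then have "l \<noteq> 1" using L dist by auto
    have inv: "1 / (A * t3 + C * h) = 1 / (A * t1 + C * h) + l * (1 / (A * t2 + C * h) - 1 / (A * t1 + C * h))"
      "t3 / (A * t3 + C * h) = t1 / (A * t1 + C * h) + l * (t2 / (A * t2 + C * h) - t1 / (A * t1 + C * h))"
      unfolding l_def using L dist by (simp_all add: divide_simps) (simp_all add: algebra_simps)
    \<comment> \<open>Up to constant factors, \<open>q\<close> and \<open>r\<close> are the
      coordinates \<open>x\<close> and \<open>w\<close>. The height
      \<open>y = \<sigma> (q - t1 r)\<close> is linear in them, so the three points lie on a line of
      the plane.\<close>
    define r where "r = (\<lambda>t. 1 / (A * t + C * h))"
    define q where "q = (\<lambda>t. t / (A * t + C * h))"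
    have P: "?P t = pt (- E * q t) (\<sigma> * (q t - t1 * r t)) (- E * h * r t)" for t
      using assms(5) by (simp add: pt_eq q_def r_def diff_divide_distrib right_diff_distrib)
    have rq: "r t3 = r t1 + l * (r t2 - r t1)" "q t3 = q t1 + l * (q t2 - q t1)"
      using inv by (simp_all add: r_def q_def)
    have "?P t1 + l *\<^sub>R (?P t2 - ?P t1) = ?P t3"
      unfolding P pt_line pt_eq rq by (simp add: algebra_simps)
    moreover have "?P t1 \<noteq> ?P t2"
    proof
      assume "?P t1 = ?P t2"
      then have "r t1 = r t2" "q t1 = q t2" unfolding P pt_eq using 3 assms by simp_all
      then show False using dist(1) L(1,2) by (auto simp: r_def q_def)
    qed
    ultimately show False
      using three[of "?P t1" "?P t2" l] on[of t1] on[of t2] on[of t3] \<open>l \<noteq> 0\<close> \<open>l \<noteq> 1\<close> by simp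
  next
    case 4
    define O' where "O' = pt 0 (- E / B) 0"
    have O': "O' \<in> S" unfolding O'_def mem using 4 by (simp add: F_def)
    obtain P where P: "P \<in> S" "P \<noteq> O'" using nondegenerate_conic_other_point[OF nd] by blast
    obtain x y w where xyw: "P = pt x y w" "F x y w = 0" "B * y + E = 0"
      using P(1) 4 unfolding S_eq by auto
    have y: "y = - E / B" using xyw(3) 4 by (simp add: field_simps)
    \<comment> \<open>For fixed \<open>y\<close>, \<open>F\<close> is a quadratic form in
      \<open>x\<close> and \<open>w\<close>, so the section is a cone with apex
      \<open>O'\<close>.\<close>
    have "F (2 * x) y (2 * w) = 4 * F x y w"
      unfolding F_def by (simp add: power2_eq_square algebra_simps)
    then have "pt (2 * x) y (2 * w) \<in> S" unfolding mem using xyw 4 by simp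
    moreover have "O' + 2 *\<^sub>R (P - O') = pt (2 * x) y (2 * w)"
      unfolding O'_def xyw(1) pt_line y by simp
    ultimately show False using three[OF O' P(1), of 2] P(2) by simp
  next
    case 5
    define \<gamma> where "\<gamma> = - E / B"
    \<comment> \<open>The zeros of \<open>p\<close> are the \<open>t\<close> to avoid: those where
      \<open>w\<close> cannot be solved for, and those with a ruling through the point
      \<open>y = \<gamma>\<close> of the double line.\<close>
    define p where "p = [:C * h, A:] * [:b\<^sup>2 * a\<^sup>2 - \<gamma>\<^sup>2 * (a\<^sup>2 + d\<^sup>2), 2 * d * \<gamma>\<^sup>2, - b\<^sup>2:]"
    have "p \<noteq> 0" unfolding p_def using 5 assms by auto
    then have "finite {t. poly p t = 0}" by (rule poly_roots_finite)
    moreover have "infinite {- a<..<a}" using ad by simp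
    ultimately obtain t where t: "- a < t" "t < a" "poly p t \<noteq> 0"
      by (metis (mono_tags, lifting) finite_subset greaterThanLessThan_iff mem_Collect_eq subsetI)
    have p_t: "poly p t = (A * t + C * h) *
        (b\<^sup>2 * (a\<^sup>2 - t\<^sup>2) - \<gamma>\<^sup>2 * (a\<^sup>2 + d\<^sup>2 - 2 * d * t))"
      by (simp add: p_def algebra_simps power2_eq_square)
    have l: "A * t + C * h \<noteq> 0" and ne: "\<gamma>\<^sup>2 * (a\<^sup>2 + d\<^sup>2 - 2 * d * t) \<noteq> b\<^sup>2 * (a\<^sup>2 - t\<^sup>2)"
      using t(3) p_t by auto
    have "0 < (a - d)\<^sup>2" using ad by simp
    also have "(a - d)\<^sup>2 = a\<^sup>2 + d\<^sup>2 - 2 * d * a" by (simp add: power2_eq_square algebra_simps)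
    also have "\<dots> \<le> a\<^sup>2 + d\<^sup>2 - 2 * d * t" using t assms by simp
    finally have kt: "a\<^sup>2 + d\<^sup>2 - 2 * d * t > 0" .
    have "a\<^sup>2 - t\<^sup>2 = (a - t) * (a + t)" by (simp add: power2_eq_square algebra_simps)
    also have "\<dots> > 0" using t by simp
    finally have at: "a\<^sup>2 - t\<^sup>2 > 0" .
    \<comment> \<open>The value of \<open>y^2\<close> on the two rulings over
      \<open>t\<close>.\<close>
    define g where "g = b\<^sup>2 * (a\<^sup>2 - t\<^sup>2) / (a\<^sup>2 + d\<^sup>2 - 2 * d * t)"
    have g: "g > 0" "\<gamma>\<^sup>2 \<noteq> g" "g * (a\<^sup>2 + d\<^sup>2 - 2 * d * t) = b\<^sup>2 * (a\<^sup>2 - t\<^sup>2)"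
      unfolding g_def using at kt ne assms by (simp_all add: field_simps)
    define Y where "Y = sqrt g"
    have Y: "Y > 0" "Y\<^sup>2 = g" using g by (simp_all add: Y_def)
    have Yne: "Y \<noteq> \<gamma>" "- Y \<noteq> \<gamma>" using g(2) Y(2) by auto
    define w where "w = (\<lambda>y. B * h * (\<gamma> - y) / (A * t + C * h))"
    have pl: "A * (t * w y / h) + B * y + C * w y + E = 0" for y
    proof -
      have "A * (t * w y / h) + C * w y = (A * t + C * h) * w y / h"
        using assms by (simp add: field_simps)
      also have "\<dots> = B * (\<gamma> - y)" using l assms by (simp add: w_def)
      also have "\<dots> = - E - B * y" using 5 by (simp add: \<gamma>_def right_diff_distrib)
      finally show ?thesis by simp
    qed
    let ?P = "\<lambda>y. pt (t * w y / h) y (w y)"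
    have w\<gamma>: "w \<gamma> = 0" by (simp add: w_def)
    have on: "?P \<gamma> \<in> S" "?P Y \<in> S" "?P (- Y) \<in> S"
      unfolding mem F_ruling by (rule conjI[OF _ pl], simp add: w\<gamma> Y(2) g(3))+
    \<comment> \<open>The ratio for the \<open>y\<close> coordinates \<open>\<gamma>\<close>,
      \<open>Y\<close>, \<open>- Y\<close>; it serves the other coordinates too, because
      \<open>w\<close> is affine in \<open>y\<close>.\<close>
    define l where "l = (- Y - \<gamma>) / (Y - \<gamma>)"
    have l01: "l \<noteq> 0" "l \<noteq> 1" using Yne Y by (auto simp: l_def)
    have lY: "l * (Y - \<gamma>) = - Y - \<gamma>" using Yne by (simp add: l_def)
    have w: "w y = (B * h / (A * t + C * h)) * (\<gamma> - y)" for y by (simp add: w_def)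
    have lw: "l * w Y = w (- Y)"
    proof -
      have "l * w Y = (B * h / (A * t + C * h)) * (- (l * (Y - \<gamma>)))"
        unfolding w by (simp add: algebra_simps)
      then show ?thesis unfolding lY w by simp
    qed
    have "?P \<gamma> + l *\<^sub>R (?P Y - ?P \<gamma>) = ?P (- Y)"
      unfolding pt_line pt_eq w\<gamma> using lw lY by simp
    then show False using three[of "?P \<gamma>" "?P Y" l] on l01 Yne by (simp add: pt_eq)
  qed
qed

end
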